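(* Let $a, b$ be relatively prime positive integers such that $\frac{a}{b} \geq 2$. Then $\textbf{w}_{a/b} = \textbf{w}_a$. In particular, $\rho(\frac{a}{b}) = a$.
   Context: Words are indexed from position $0$; a factor is a contiguous subword. For relatively prime positive integers $a,b$ and a nonempty word $v$ whose length is divisible by $b$, define $v^{a/b} = v^{\lfloor a/b \rfloor} v_0 v_1 \cdots v_{t-1}$, where $t = |v|\,(a/b - \lfloor a/b\rfloor)$; such a word is called an $\frac{a}{b}$-power. A word is $\frac{a}{b}$-power-free if none of its factors is an $\frac{a}{b}$-power. For $\frac{a}{b} > 1$, $\textbf{w}_{a/b}$ denotes the lexicographically least infinite word over $\mathbb{Z}_{\geq 0}$ that is $\frac{a}{b}$-power-free; for an integer $a$, $\textbf{w}_a = \textbf{w}_{a/1}$. For an integer $k \geq 2$, an integer sequence $s(i)_{i \geq 0}$ is $k$-regular if the $\mathbb{Z}$-module generated by $\{ s(k^e i + j)_{i \geq 0} : e \geq 0,\ 0 \leq j \leq k^e - 1 \}$ is finitely generated. Integers $k,l \geq 2$ are multiplicatively dependent ($k \sim l$) if $k^s = l^t$ for some positive integers $s,t$. The set of $k \geq 2$ for which the letter sequence of $\textbf{w}_{a/b}$ is $k$-regular, when nonempty, is a single $\sim$-class; this class is denoted $\rho(\frac{a}{b})$, and one writes $\rho(\frac{a}{b}) = k$ to mean that $k$ belongs to this class (i.e., the letter sequence of $\textbf{w}_{a/b}$ is $l$-regular exactly for those $l \geq 2$ with $l \sim k$). *)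

theory Defs
  imports
    Complex_Main
    "HOL-Library.Omega_Words_Fun"
    "HOL-Library.Fun_Lexorder"
    "HOL-Library.Function_Algebras"
begin

section \<open>Fractional powers and the lexicographically least word avoiding them\<close>

text \<open>
  For coprime positive \<open>a\<close>, \<open>b\<close> and \<open>b dvd length v\<close> this is $v^{a/b}$: here \<open>a div b\<close> is
  $\lfloor a/b \rfloor$ and, since $a/b - \lfloor a/b \rfloor = (a \bmod b)/b$, the division
  in the length $t = |v|(a/b - \lfloor a/b \rfloor)$ of the partial copy of \<open>v\<close> is exact.
\<close>

definition frac_power :: "nat \<Rightarrow> nat \<Rightarrow> 'a list \<Rightarrow> 'a list" where
  "frac_power a b v =
     concat (replicate (a div b) v) @ take (length v * (a mod b) div b) v"

definition is_frac_power :: "nat \<Rightarrow> nat \<Rightarrow> 'a list \<Rightarrow> bool" where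
  "is_frac_power a b u \<longleftrightarrow> (\<exists>v. v \<noteq> [] \<and> b dvd length v \<and> u = frac_power a b v)"

definition frac_power_free :: "nat \<Rightarrow> nat \<Rightarrow> 'a word \<Rightarrow> bool" where
  "frac_power_free a b w \<longleftrightarrow> (\<forall>i j. \<not> is_frac_power a b (w [i \<rightarrow> j]))"

definition is_lex_least_free :: "nat \<Rightarrow> nat \<Rightarrow> nat word \<Rightarrow> bool" where
  "is_lex_least_free a b w \<longleftrightarrow>
     frac_power_free a b w \<and> (\<forall>u. frac_power_free a b u \<longrightarrow> u = w \<or> less_fun w u)"

text \<open>
  The word $\mathbf{w}_{a/b}$; it exists and is unique for $a/b > 1$ by
  \<open>is_lex_least_free_ex1\<close> below.
\<close>

definition lex_least_word :: "nat \<Rightarrow> nat \<Rightarrow> nat word" where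
  "lex_least_word a b = (THE w. is_lex_least_free a b w)"

lemma not_distinct_frac_power:
  assumes "0 < b" "b < a" "is_frac_power a b u"
  shows "\<not> distinct u"
proof -
  obtain v where v: "v \<noteq> []" "b dvd length v" and u: "u = frac_power a b v"
    using assms(3) by (auto simp: is_frac_power_def)
  obtain q where q: "a div b = Suc q"
    using assms(1,2) by (metis div_greater_zero_iff gr0_implies_Suc less_imp_le)
  define rest where
    "rest = concat (replicate q v) @ take (length v * (a mod b) div b) v"
  have u': "u = v @ rest"
    by (simp add: u frac_power_def q rest_def)
  have "hd v \<in> set rest"
  proof (cases q)
    case 0
    have "a mod b \<noteq> 0"
      using q 0 assms(2) by (metis One_nat_def mod_0_imp_dvd dvd_div_mult_self
          less_irrefl nat_mult_1)
    moreover have "b \<le> length v"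
      using v by (simp add: dvd_imp_le)
    ultimately have "b \<le> length v * (a mod b)"
      by (metis One_nat_def Suc_leI le_trans mult.right_neutral mult_le_mono neq0_conv)
    hence "0 < length v * (a mod b) div b"
      using assms(1) by (simp add: div_greater_zero_iff)
    hence "hd v \<in> set (take (length v * (a mod b) div b) v)"
      using v(1) by (cases v; cases "length v * (a mod b) div b") auto
    thus ?thesis by (simp add: rest_def)
  next
    case (Suc p)
    thus ?thesis using v(1) by (simp add: rest_def)
  qed
  with v(1) show ?thesis by (metis disjoint_iff distinct_append hd_in_set u')
qed

lemma is_lex_least_free_ex1:
  assumes "0 < b" "b < a"
  shows "\<exists>!w. is_lex_least_free a b w"
proof (rule ex_ex1I)
  let ?F = "frac_power_free a b :: nat word \<Rightarrow> bool"
  have "?F id"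
    using not_distinct_frac_power[OF assms]
    by (metis distinct_upt frac_power_free_def list.map_id subsequence_def)
  define S where
    "S = rec_nat {u. ?F u} (\<lambda>n A. {u \<in> A. u n = (LEAST c. \<exists>u\<in>A. u n = c)})"
  define m where "m n = (LEAST c. \<exists>u \<in> S n. u n = c)" for n
  have S0: "S 0 = {u. ?F u}" and SS: "S (Suc n) = {u \<in> S n. u n = m n}" for n
    by (simp_all add: S_def m_def)
  have ne: "S n \<noteq> {}" for n
  proof (induction n)
    case 0
    show ?case using \<open>?F id\<close> by (auto simp: S0)
  next
    case (Suc n)
    hence "\<exists>c. \<exists>u \<in> S n. u n = c" by blast
    hence "\<exists>u \<in> S n. u n = m n" unfolding m_def by (rule LeastI_ex)
    thus ?case by (auto simp: SS)
  qed
  have S_iff: "u \<in> S n \<longleftrightarrow> ?F u \<and> (\<forall>k<n. u k = m k)" for u n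
    by (induction n) (auto simp: S0 SS less_Suc_eq)
  have "?F m"
    unfolding frac_power_free_def
  proof (intro allI)
    fix i j
    obtain u where "u \<in> S j" using ne by blast
    hence "?F u" "u [i \<rightarrow> j] = m [i \<rightarrow> j]"
      by (auto simp: S_iff subsequence_def)
    thus "\<not> is_frac_power a b (m [i \<rightarrow> j])"
      by (metis frac_power_free_def)
  qed
  moreover have "less_fun m u" if "?F u" "u \<noteq> m" for u
  proof -
    define n where "n = (LEAST n. u n \<noteq> m n)"
    have "\<exists>n. u n \<noteq> m n" using that(2) by blast
    hence n: "u n \<noteq> m n" unfolding n_def by (rule LeastI_ex)
    have lt: "\<forall>k<n. u k = m k" unfolding n_def using not_less_Least by blast
    hence "u \<in> S n" using that(1) by (simp add: S_iff)
    hence "m n \<le> u n" unfolding m_def by (intro Least_le) blast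
    with n lt show ?thesis unfolding less_fun_def by (intro exI[of _ n]) auto
  qed
  ultimately show "\<exists>w. is_lex_least_free a b w"
    unfolding is_lex_least_free_def by blast
next
  show "w = w'" if "is_lex_least_free a b w" "is_lex_least_free a b w'" for w w'
    using that unfolding is_lex_least_free_def by (metis less_fun_asym)
qed

section \<open>Regular sequences\<close>

global_interpretation int_seq: module "\<lambda>(c::int) (s::nat \<Rightarrow> int) i. c * s i"
  by unfold_locales (auto simp: fun_eq_iff algebra_simps)

definition kernel_seqs :: "nat \<Rightarrow> (nat \<Rightarrow> int) \<Rightarrow> (nat \<Rightarrow> int) set" where
  "kernel_seqs k s = {(\<lambda>i. s (k ^ e * i + j)) | e j. j \<le> k ^ e - 1}"

definition k_regular :: "nat \<Rightarrow> (nat \<Rightarrow> int) \<Rightarrow> bool" where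
  "k_regular k s \<longleftrightarrow> (\<exists>G. finite G \<and> int_seq.span G = int_seq.span (kernel_seqs k s))"

definition mult_dependent :: "nat \<Rightarrow> nat \<Rightarrow> bool" where
  "mult_dependent k l \<longleftrightarrow> 2 \<le> k \<and> 2 \<le> l \<and> (\<exists>s t. 0 < s \<and> 0 < t \<and> k ^ s = l ^ t)"

definition mult_class :: "nat \<Rightarrow> nat set" where
  "mult_class k = {l. mult_dependent k l}"

text \<open>
  \<open>rho a b\<close> is a set of bases, so $\rho(a/b) = k$, meaning that \<open>k\<close> represents the class
  $\rho(a/b)$, is written \<open>rho a b = mult_class k\<close>.
\<close>

definition rho :: "nat \<Rightarrow> nat \<Rightarrow> nat set" where
  "rho a b = {k. 2 \<le> k \<and> k_regular k (\<lambda>i. int (lex_least_word a b i))}"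

end

theory Submission
  imports Defs "HOL-Computational_Algebra.Primes"
begin

section \<open>Multiplicities of an arbitrary base\<close>

text \<open>For a/b >= 2 the least word is explicit and independent of b: its letter at i is the
  largest n such that a^n divides i + 1 (\<open>ruler\<close>). It is free because inside a power of
  period p every position has a partner at distance p. With d the multiplicity of a in p, this keeps
  multiples of a^(d+1) out of the power, although its length is at least a^(d+1)
  (\<open>ruler_frac_power_free\<close>). It is least because any smaller letter completes an a-th
  power, which is also an a/b-power (\<open>ruler_lowered_not_free\<close>).

  What remains is the regularity of the ruler sequence. If some powers of l and a coincide, its
  l-kernel reduces to finitely many sequences plus constants (\<open>k_regular_ruler\<close>).
  Otherwise, regularity would yield an N such that members of the span vanishing below N are zero
  (\<open>finite_span_determined\<close>), whereas \<open>power_gap\<close> supplies two distinct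
  kernel sequences that agree below N (\<open>not_k_regular_ruler\<close>).\<close>

lemma multiplicity_cong_dvd:
  assumes "\<And>n. p ^ n dvd x \<longleftrightarrow> p ^ n dvd y"
  shows "multiplicity p x = multiplicity p y"
  using assms by (simp add: multiplicity_def)

text \<open>Up to exponent e, adding y does not affect divisibility; beyond e, neither side is
  divisible. This works for composite a too.\<close>

lemma multiplicity_add_dvd:
  fixes a e x y :: nat
  assumes x: "\<not> a ^ e dvd x" and y: "a ^ e dvd y"
  shows "multiplicity a (x + y) = multiplicity a x"
proof (rule multiplicity_cong_dvd)
  fix n
  show "a ^ n dvd x + y \<longleftrightarrow> a ^ n dvd x"
  proof (cases "n \<le> e")
    case True
    with y have "a ^ n dvd y" by (meson dvd_trans le_imp_power_dvd)
    then show ?thesis by (simp add: dvd_add_left_iff)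
  next
    case False
    then have "a ^ e dvd a ^ n" by (simp add: le_imp_power_dvd)
    moreover have "\<not> a ^ e dvd x + y" using x y by (simp add: dvd_add_left_iff)
    ultimately show ?thesis using x by (meson dvd_trans)
  qed
qed

text \<open>Modulo a^e, x is the negative of y, and negation preserves divisibility.\<close>

lemma multiplicity_eq_if_dvd_add:
  fixes a e x y :: nat
  assumes y: "\<not> a ^ e dvd y" and xy: "a ^ e dvd x + y"
  shows "multiplicity a x = multiplicity a y"
proof (rule multiplicity_cong_dvd)
  fix n
  show "a ^ n dvd x \<longleftrightarrow> a ^ n dvd y"
  proof (cases "n \<le> e")
    case True
    with xy have "a ^ n dvd x + y" by (meson dvd_trans le_imp_power_dvd)
    then show ?thesis by (metis dvd_add_left_iff dvd_add_right_iff)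
  next
    case False
    then have "a ^ e dvd a ^ n" by (simp add: le_imp_power_dvd)
    moreover have "\<not> a ^ e dvd x" using y xy by (metis dvd_add_right_iff)
    ultimately show ?thesis using y by (meson dvd_trans)
  qed
qed

text \<open>For composite a, multiplicities need not add over products (take a = 4 and 2 * 2), but
  they do when one factor is a power of a.\<close>

lemma multiplicity_power_mult:
  fixes a n x :: nat
  assumes "2 \<le> a" "0 < x"
  shows "multiplicity a (a ^ n * x) = n + multiplicity a x"
proof (rule multiplicity_eqI)
  show "a ^ (n + multiplicity a x) dvd a ^ n * x"
    by (simp add: power_add multiplicity_dvd)
  have "\<not> a ^ Suc (multiplicity a x) dvd x"
    using assms by (subst power_dvd_iff_le_multiplicity) auto
  then have "\<not> a ^ n * a ^ Suc (multiplicity a x) dvd a ^ n * x"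
    using assms by (subst nat_mult_dvd_cancel1) auto
  then show "\<not> a ^ Suc (n + multiplicity a x) dvd a ^ n * x"
    by (simp only: add_Suc_right[symmetric] power_add not_False_eq_True)
qed

text \<open>Words start at 0, hence the shift; it also avoids the default value of
  \<open>multiplicity\<close> at 0.\<close>

definition ruler :: "nat \<Rightarrow> nat word" where
  "ruler a i = multiplicity a (Suc i)"

section \<open>Fractional powers by periods\<close>

lemma length_concat_replicate: "length (concat (replicate n v)) = n * length v"
  by (induction n) auto

lemma nth_concat_replicate:
  "k < n * length v \<Longrightarrow> concat (replicate n v) ! k = v ! (k mod length v)"
proof (induction n arbitrary: k)
  case (Suc n)
  show ?case
  proof (cases "k < length v")
    case False
    then have "concat (replicate n v) ! (k - length v) = v ! ((k - length v) mod length v)"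
      using Suc.prems by (intro Suc.IH) auto
    then show ?thesis using False by (simp add: nth_append le_mod_geq)
  qed (simp add: nth_append)
qed simp

text \<open>Cut v into b blocks of equal length; the power consists of a such blocks.\<close>

lemma length_frac_power:
  assumes "0 < b" "b dvd length v"
  shows "length (frac_power a b v) = a * (length v div b)"
proof -
  obtain m where m: "length v = b * m" using assms(2) by blast
  have "a mod b \<le> b" using assms(1) by simp
  then have "m * (a mod b) \<le> length v" by (simp add: m mult.commute)
  moreover have "length v * (a mod b) div b = m * (a mod b)"
    using assms(1) by (simp add: m mult.assoc)
  ultimately have "length (take (length v * (a mod b) div b) v) = m * (a mod b)"
    by (simp only: length_take min_absorb2)
  then have "length (frac_power a b v) = a div b * (b * m) + m * (a mod b)"
    by (simp only: frac_power_def length_append length_concat_replicate m)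
  also have "\<dots> = (a div b * b + a mod b) * m" by (simp only: algebra_simps)
  also have "\<dots> = a * (length v div b)" using assms(1) m by simp
  finally show ?thesis .
qed

lemma nth_frac_power:
  assumes "k < length (frac_power a b v)"
  shows "frac_power a b v ! k = v ! (k mod length v)"
proof (cases "k < a div b * length v")
  case True
  then show ?thesis
    by (simp add: frac_power_def nth_append length_concat_replicate nth_concat_replicate)
next
  case False
  define r where "r = k - a div b * length v"
  have k: "k = a div b * length v + r" using False by (simp add: r_def)
  have r: "r < length v" "r < length v * (a mod b) div b"
    using assms by (auto simp: frac_power_def length_concat_replicate k)
  then have "k mod length v = r" by (simp add: k)
  then show ?thesis using r
    by (simp add: frac_power_def nth_append length_concat_replicate k)
qed

text \<open>Both words have length \<open>a * length z\<close> and repeat z. So avoiding a/b-powers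
  entails avoiding a-th powers.\<close>

lemma frac_power_concat_replicate:
  assumes "0 < b"
  shows "frac_power a b (concat (replicate b z)) = concat (replicate a z)" (is "?l = ?r")
proof (rule nth_equalityI)
  show len: "length ?l = length ?r"
    using assms by (simp add: length_frac_power length_concat_replicate)
  fix k assume k: "k < length ?l"
  then have ka: "k < a * length z" using len by (simp add: length_concat_replicate)
  then have "0 < length z" by (cases "length z") auto
  then have "k mod (b * length z) < b * length z" using assms by simp
  then have "?l ! k = z ! (k mod (b * length z) mod length z)"
    using k by (simp add: nth_frac_power length_concat_replicate nth_concat_replicate)
  also have "\<dots> = ?r ! k" using ka by (simp add: nth_concat_replicate mod_mod_cancel)
  finally show "?l ! k = ?r ! k" .
qed

section \<open>The ruler word is the lexicographically least one\<close>

text \<open>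
  Two overlapping occurrences at distance \<open>b * m\<close> cannot see a position divisible by
  \<open>a\<close> to the power one more than the multiplicity \<open>d\<close> of \<open>a\<close> in \<open>b * m\<close>, so the
  power has length below \<open>a ^ Suc d\<close>; but coprimality makes \<open>a ^ d\<close> a divisor of \<open>m\<close>.
\<close>

lemma ruler_frac_power_free:
  assumes b: "0 < b" and ab: "2 * b \<le> a" and co: "coprime a b"
  shows "frac_power_free a b (ruler a)"
  unfolding frac_power_free_def
proof (intro allI notI)
  fix i j assume "is_frac_power a b ((ruler a) [i \<rightarrow> j])"
  then obtain v where v: "v \<noteq> []" "b dvd length v" and u: "(ruler a) [i \<rightarrow> j] = frac_power a b v"
    by (auto simp: is_frac_power_def)
  obtain m where m: "length v = b * m" using v(2) by blast
  have m0: "0 < m" using m v(1) by (cases m) auto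
  have a2: "2 \<le> a" using ab b by simp
  have len: "length (frac_power a b v) = a * m"
    using length_frac_power[OF b v(2)] b by (simp add: m)
  then have ji: "j - i = a * m" using u by (metis subsequence_length)
  have val: "ruler a (i + k) = v ! (k mod (b * m))" if "k < a * m" for k
    using nth_frac_power[of k a b v] that ji
    by (simp add: len m flip: u)
  define p where "p = b * m"
  define d where "d = multiplicity a p"
  have p0: "0 < p" using b m0 by (simp add: p_def)
  have nd: "\<not> a ^ Suc d dvd p"
    using a2 p0 by (subst power_dvd_iff_le_multiplicity) (auto simp: d_def)
  \<comment> \<open>This is where a/b >= 2 enters: a position without a partner p to its right has
    one p to its left.\<close>
  have pp: "2 * p \<le> a * m" using ab by (simp add: p_def)
  \<comment> \<open>The letters of the factor are the multiplicities of the numbers x with i < x and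
    x \<le> i + a * m.\<close>
  have per: "multiplicity a (x + p) = multiplicity a x" if "i < x" "x + p \<le> i + a * m" for x
  proof -
    define k where "k = x - Suc i"
    have x: "x = Suc (i + k)" using that by (simp add: k_def)
    have k: "k + p < a * m" using that x by simp
    have "ruler a (i + (k + p)) = ruler a (i + k)"
      using val[of "k + p"] val[of k] k by (simp add: p_def)
    then show ?thesis by (simp add: ruler_def x add.assoc)
  qed
  have no1: "\<not> a ^ Suc d dvd x" if "i < x" "x + p \<le> i + a * m" for x
  proof
    assume dv: "a ^ Suc d dvd x"
    have "multiplicity a (x + p) = d"
      using multiplicity_add_dvd[OF nd dv] by (simp add: add.commute d_def)
    moreover have "Suc d \<le> multiplicity a x"
      using dv a2 that by (intro multiplicity_geI) auto
    ultimately show False using per[OF that] by simp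
  qed
  have no: "\<not> a ^ Suc d dvd x" if "i < x" "x \<le> i + a * m" for x
  proof (cases "x + p \<le> i + a * m")
    case True
    then show ?thesis using no1 that by blast
  next
    case False
    define y where "y = x - p"
    have y: "x = y + p" "i < y" "y + p \<le> i + a * m"
      using False pp that by (auto simp: y_def)
    have "Suc d > multiplicity a y"
      using no1[OF y(2,3)] multiplicity_dvd' not_less_eq_eq not_le_imp_less by blast
    then have "Suc d > multiplicity a x" using per[OF y(2,3)] y(1) by simp
    then show ?thesis using that a2 by (subst power_dvd_iff_le_multiplicity) auto
  qed
  have "a ^ d dvd b * m" using multiplicity_dvd[of a p] by (simp add: d_def p_def)
  then have "a ^ d dvd m" using co by (simp add: coprime_dvd_mult_right_iff)
  then have "a ^ d \<le> m" using m0 by (rule dvd_imp_le)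
  then have le: "a ^ Suc d \<le> a * m" by simp
  \<comment> \<open>The least multiple of \<open>a ^ Suc d\<close> exceeding i.\<close>
  define x where "x = Suc (i div a ^ Suc d) * a ^ Suc d"
  have "i < x" unfolding x_def using a2
    by (metis add.commute dividend_less_div_times less_le_trans mult_Suc pos2 zero_less_power order_refl)
  moreover have "x \<le> i + a ^ Suc d"
    unfolding x_def using div_times_less_eq_dividend[of i "a ^ Suc d"] by simp
  moreover have "a ^ Suc d dvd x" by (simp only: x_def dvd_triv_right)
  ultimately show False using no[of x] le by linarith
qed

text \<open>
  Lowering a letter of the ruler word to \<open>c\<close> completes a power \<open>z\<^sup>a\<close> with
  \<open>length z = a ^ c\<close>, and \<open>z\<^sup>a\<close> is the fractional power \<open>(z\<^sup>b)\<^bsup>a/b\<^esup>\<close>.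
\<close>

lemma ruler_lowered_not_free:
  assumes b: "0 < b" and a2: "2 \<le> a"
    and eq: "\<And>k. k < n \<Longrightarrow> u k = ruler a k" and lt: "u n < ruler a n"
  shows "\<not> frac_power_free a b u"
proof -
  define c where "c = u n"
  define A where "A = a ^ c"
  define B where "B = a ^ Suc c"
  have AB: "B = a * A" by (simp add: A_def B_def)
  have A0: "0 < A" and B0: "0 < B" using a2 by (auto simp: A_def B_def)
  have Bn: "B dvd Suc n" using lt unfolding B_def c_def ruler_def
    by (intro multiplicity_dvd') simp
  then have BleN: "B \<le> Suc n" by (rule dvd_imp_le) simp
  define s where "s = Suc n - B"
  have s: "s + B = Suc n" using BleN by (simp add: s_def)
  have Bs: "B dvd s" using Bn s by (metis dvd_add_left_iff dvd_refl)
  \<comment> \<open>The ruler word truncated at height c, which has period \<open>A\<close>. On the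
    window of \<open>B\<close> letters ending at n, only the last letter of the ruler word exceeds
    c, and there u has c.\<close>
  define g where "g k = (if A dvd Suc k then c else multiplicity a (Suc k))" for k
  have us: "u (s + k) = g k" if k: "k < B" for k
  proof (cases "Suc k = B")
    case True
    then have "s + k = n" using s by simp
    moreover have "A dvd Suc k" using True AB by simp
    ultimately show ?thesis by (simp add: g_def c_def)
  next
    case False
    then have kB: "Suc k < B" using k by simp
    then have nB: "\<not> B dvd Suc k" by (auto dest: dvd_imp_le)
    have "u (s + k) = multiplicity a (Suc k + s)"
      using kB s by (subst eq) (auto simp: ruler_def add.commute)
    also have "\<dots> = multiplicity a (Suc k)"
      using nB Bs unfolding B_def by (rule multiplicity_add_dvd)
    also have "\<dots> = g k"
      using nB by (auto simp: g_def A_def B_def intro: multiplicity_eqI)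
    finally show ?thesis .
  qed
  have gper: "g k = g (k mod A)" for k
  proof -
    have k: "Suc k = Suc (k mod A) + A * (k div A)" by simp
    have "A dvd Suc k \<longleftrightarrow> A dvd Suc (k mod A)"
      by (subst k) (simp only: dvd_add_left_iff dvd_triv_left)
    moreover have "multiplicity a (Suc k) = multiplicity a (Suc (k mod A))"
      if "\<not> A dvd Suc (k mod A)"
      using multiplicity_add_dvd[of a c "Suc (k mod A)" "A * (k div A)"] that
      by (subst k) (simp add: A_def)
    ultimately show ?thesis by (simp add: g_def)
  qed
  define z where "z = map g [0..<A]"
  have "u [s \<rightarrow> Suc n] = concat (replicate a z)"
  proof (rule nth_equalityI)
    show "length (u [s \<rightarrow> Suc n]) = length (concat (replicate a z))"
      using s AB by (simp add: length_concat_replicate z_def)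
    fix k assume "k < length (u [s \<rightarrow> Suc n])"
    then have k: "k < B" using s by simp
    have "u [s \<rightarrow> Suc n] ! k = u (s + k)"
      using k s unfolding subsequence_def by (subst nth_map) (auto simp del: upt_Suc)
    then show "u [s \<rightarrow> Suc n] ! k = concat (replicate a z) ! k"
      using k us[OF k] gper[of k] s A0 AB
      by (simp add: nth_concat_replicate z_def)
  qed
  then have "u [s \<rightarrow> Suc n] = frac_power a b (concat (replicate b z))"
    using b by (simp add: frac_power_concat_replicate)
  moreover have "length (concat (replicate b z)) = b * A"
    by (simp add: length_concat_replicate z_def)
  moreover from this have "concat (replicate b z) \<noteq> []" using b A0 by auto
  ultimately show ?thesis
    unfolding frac_power_free_def is_frac_power_def by (metis dvd_triv_left)
qed

lemma ruler_is_lex_least_free: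
  assumes "0 < b" "2 * b \<le> a" "coprime a b"
  shows "is_lex_least_free a b (ruler a)"
  unfolding is_lex_least_free_def
proof (intro conjI allI impI)
  show "frac_power_free a b (ruler a)" using assms by (rule ruler_frac_power_free)
  fix u :: "nat word" assume free: "frac_power_free a b u"
  show "u = ruler a \<or> less_fun (ruler a) u"
  proof (rule disjCI)
    assume "\<not> less_fun (ruler a) u"
    show "u = ruler a"
    proof
      fix n show "u n = ruler a n"
      proof (induction n rule: less_induct)
        case (less n)
        have "\<not> u n < ruler a n"
          using ruler_lowered_not_free[of b a n u] free less assms by auto
        moreover have "\<not> ruler a n < u n"
          using \<open>\<not> less_fun (ruler a) u\<close> less by (auto simp: less_fun_def)
        ultimately show ?case by simp
      qed
    qed
  qed
qed

lemma lex_least_word_eq_ruler: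
  assumes "0 < b" "2 * b \<le> a" "coprime a b"
  shows "lex_least_word a b = ruler a"
  unfolding lex_least_word_def
  using is_lex_least_free_ex1[of b a] ruler_is_lex_least_free[OF assms] assms
  by (intro the1_equality) auto

section \<open>Regularity of the ruler sequence\<close>

text \<open>The kernel sequence with residue j has y = j + 1. Keeping q and y free allows powers of
  a to be split off.\<close>

definition dilated_ruler :: "nat \<Rightarrow> nat \<Rightarrow> nat \<Rightarrow> nat \<Rightarrow> int" where
  "dilated_ruler a q y i = int (multiplicity a (q * i + y))"

lemma kernel_seqs_ruler:
  assumes "0 < l"
  shows "kernel_seqs l (\<lambda>i. int (ruler a i)) =
    {dilated_ruler a (l ^ e) y | e y. 1 \<le> y \<and> y \<le> l ^ e}" (is "?l = ?r")
proof (intro equalityI subsetI)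
  fix f assume "f \<in> ?l"
  then obtain e j where j: "j \<le> l ^ e - 1" "f = (\<lambda>i. int (ruler a (l ^ e * i + j)))"
    by (auto simp: kernel_seqs_def)
  then have "f = dilated_ruler a (l ^ e) (Suc j)"
    by (auto simp: ruler_def dilated_ruler_def)
  moreover have "Suc j \<le> l ^ e" using j(1) assms
    by (metis One_nat_def Suc_leI le_diff_conv2 add.commute plus_1_eq_Suc zero_less_power)
  ultimately show "f \<in> ?r" by (intro CollectI exI[of _ e] exI[of _ "Suc j"]) auto
next
  fix f assume "f \<in> ?r"
  then obtain e y where y: "1 \<le> y" "y \<le> l ^ e" "f = dilated_ruler a (l ^ e) y" by blast
  then have "f = (\<lambda>i. int (ruler a (l ^ e * i + (y - 1))))"
    by (auto simp: ruler_def dilated_ruler_def)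
  then show "f \<in> ?l" using y(2) unfolding kernel_seqs_def
    by (intro CollectI exI[of _ e] exI[of _ "y - 1"]) auto
qed

section \<open>Bases multiplicatively dependent on \<open>a\<close>\<close>

text \<open>The factor \<open>int n * 1\<close> exhibits the constant as a scalar multiple of the
  sequence 1 in \<open>int_seq\<close>.\<close>

lemma dilated_ruler_power:
  assumes a2: "2 \<le> a" and z: "0 < z"
  shows "dilated_ruler a (a ^ n * q) (a ^ n * z) = (\<lambda>i. int n * 1) + dilated_ruler a q z"
proof
  fix i
  have "a ^ n * q * i + a ^ n * z = a ^ n * (q * i + z)" by (simp add: algebra_simps)
  then show "dilated_ruler a (a ^ n * q) (a ^ n * z) i = ((\<lambda>i. int n * 1) + dilated_ruler a q z) i"
    using multiplicity_power_mult[OF a2, of "q * i + z" n] z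
    by (simp add: dilated_ruler_def)
qed

lemma dilated_ruler_const:
  assumes "\<not> a ^ n dvd y"
  shows "dilated_ruler a (a ^ n * q) y = (\<lambda>i. int (multiplicity a y) * 1)"
proof
  fix i
  show "dilated_ruler a (a ^ n * q) y i = int (multiplicity a y) * 1"
    using multiplicity_add_dvd[OF assms, of "a ^ n * q * i"]
    by (simp add: dilated_ruler_def add.commute mult.assoc)
qed

text \<open>With a^t = l^s, division of e by s gives l^e = a^n * l^r with r < s. If a^n divides y,
  splitting it off leaves one of finitely many sequences plus n; otherwise the sequence is
  constant.\<close>

lemma k_regular_ruler:
  assumes dep: "mult_dependent a l"
  shows "k_regular l (\<lambda>i. int (ruler a i))"
proof -
  obtain s t where st: "0 < s" "0 < t" "a ^ t = l ^ s" and a2: "2 \<le> a" and l2: "2 \<le> l"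
    using dep by (auto simp: mult_dependent_def)
  define K where "K = kernel_seqs l (\<lambda>i. int (ruler a i))"
  have K: "K = {dilated_ruler a (l ^ e) y | e y. 1 \<le> y \<and> y \<le> l ^ e}"
    unfolding K_def using l2 by (intro kernel_seqs_ruler) simp
  define D where "D = (\<lambda>(r, y). dilated_ruler a (l ^ r) y) ` (SIGMA r:{..<s}. {1..l ^ r})"
  have DK: "D \<subseteq> K" by (auto simp: D_def K) blast
  \<comment> \<open>The spans must be equal, so the constant 1 has to come from the kernel: l^(2s) =
    a^(2t) is a multiple of a^2, so every term has the multiplicity of a itself.\<close>
  have "(\<lambda>i. 1) = dilated_ruler a (l ^ (s * 2)) a"
  proof
    fix i
    have a1: "a < a ^ 2" using a2 by (simp add: power2_eq_square)
    have "a ^ 2 dvd a ^ (t * 2)" using st by (intro le_imp_power_dvd) simp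
    then have "a ^ 2 dvd l ^ (s * 2) * i" using st by (simp add: power_mult)
    moreover have "\<not> a ^ 2 dvd a" using a1 a2 by (auto dest: dvd_imp_le)
    ultimately have "multiplicity a (a + l ^ (s * 2) * i) = multiplicity a a"
      by (intro multiplicity_add_dvd)
    also have "\<dots> = 1" using \<open>\<not> a ^ 2 dvd a\<close> by (intro multiplicity_eqI) (auto simp: power2_eq_square)
    finally show "1 = dilated_ruler a (l ^ (s * 2)) a i"
      by (simp add: dilated_ruler_def add.commute)
  qed
  moreover have "a \<le> l ^ (s * 2)"
  proof -
    have "a ^ 1 \<le> a ^ (t * 2)" using a2 st by (intro power_increasing) auto
    then show ?thesis using st by (simp add: power_mult)
  qed
  ultimately have oneK: "(\<lambda>i. 1) \<in> K" unfolding K using a2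
    by (intro CollectI exI[of _ "s * 2"] exI[of _ a]) auto
  have "K \<subseteq> int_seq.span (insert (\<lambda>i. 1) D)"
  proof
    fix f assume "f \<in> K"
    then obtain e y where y: "1 \<le> y" "y \<le> l ^ e" and f: "f = dilated_ruler a (l ^ e) y"
      by (auto simp: K)
    define n where "n = t * (e div s)"
    define r where "r = e mod s"
    have rs: "r < s" using st by (simp add: r_def)
    have "l ^ e = l ^ (s * (e div s) + r)" by (simp add: r_def)
    also have "\<dots> = a ^ n * l ^ r" using st by (simp add: power_add power_mult n_def)
    finally have le: "l ^ e = a ^ n * l ^ r" .
    show "f \<in> int_seq.span (insert (\<lambda>i. 1) D)"
    proof (cases "a ^ n dvd y")
      case True
      then obtain z where z: "y = a ^ n * z" by blast
      have z0: "0 < z" using y(1) z by (cases z) auto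
      have "z \<le> l ^ r" using y(2) a2 by (simp add: z le)
      then have "dilated_ruler a (l ^ r) z \<in> D"
        using z0 rs unfolding D_def by force
      then show ?thesis unfolding f le z dilated_ruler_power[OF a2 z0]
        by (intro int_seq.span_add int_seq.span_scale int_seq.span_base) auto
    next
      case False
      show ?thesis unfolding f le dilated_ruler_const[OF False]
        by (intro int_seq.span_scale int_seq.span_base) auto
    qed
  qed
  moreover have "insert (\<lambda>i. 1) D \<subseteq> int_seq.span K"
    using DK oneK int_seq.span_superset by blast
  ultimately have "int_seq.span (insert (\<lambda>i. 1) D) = int_seq.span K"
    by (simp add: int_seq.span_eq)
  moreover have "finite (insert (\<lambda>i. 1) D)" by (simp add: D_def)
  ultimately show ?thesis unfolding k_regular_def K_def by blast
qed

section \<open>Bases multiplicatively independent of \<open>a\<close>\<close>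

text \<open>Each new generator costs at most one further coordinate, one at which some offending
  sequence w is nonzero.\<close>

lemma finite_span_determined:
  assumes "finite G"
  shows "\<exists>N. \<forall>f \<in> int_seq.span G. (\<forall>i<N. f i = 0) \<longrightarrow> f = 0"
  using assms
proof induction
  case empty
  show ?case by simp
next
  case (insert g G)
  then obtain N where N: "\<And>f. f \<in> int_seq.span G \<Longrightarrow> (\<And>i. i < N \<Longrightarrow> f i = 0) \<Longrightarrow> f = 0"
    by blast
  show ?case
  proof (cases "\<forall>f \<in> int_seq.span (insert g G). (\<forall>i<N. f i = 0) \<longrightarrow> f = 0")
    case False
    then obtain w where w: "w \<in> int_seq.span (insert g G)" "\<And>i. i < N \<Longrightarrow> w i = 0" "w \<noteq> 0"
      by blast
    then obtain k where k: "w k \<noteq> 0" by (auto simp: fun_eq_iff)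
    obtain c where c: "w - (\<lambda>i. c * g i) \<in> int_seq.span G"
      using w(1) by (auto simp: int_seq.span_breakdown_eq)
    have c0: "c \<noteq> 0"
    proof
      assume "c = 0"
      then have "w - (\<lambda>i. c * g i) = w" by (auto simp: fun_eq_iff)
      then show False using N[of w] w c by auto
    qed
    have "f = 0" if f: "f \<in> int_seq.span (insert g G)" and z: "\<And>i. i < max N (Suc k) \<Longrightarrow> f i = 0" for f
    proof -
      obtain c' where c': "f - (\<lambda>i. c' * g i) \<in> int_seq.span G"
        using f by (auto simp: int_seq.span_breakdown_eq)
      \<comment> \<open>This combination of f and w eliminates g, so the bound for \<open>G\<close>
        applies to it; coordinate k then forces c' = 0.\<close>
      define h where "h = (\<lambda>i. c * (f - (\<lambda>i. c' * g i)) i) - (\<lambda>i. c' * (w - (\<lambda>i. c * g i)) i)"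
      have h: "h i = c * f i - c' * w i" for i by (simp add: h_def algebra_simps)
      have "h \<in> int_seq.span G" unfolding h_def
        by (intro int_seq.span_diff int_seq.span_scale c c')
      then have "h = 0" using N[of h] z w(2) by (simp add: h)
      then have hz: "c * f i = c' * w i" for i using h[of i] by simp
      have "c' = 0" using hz[of k] z[of k] k by simp
      then show "f = 0" using hz c0 by (auto simp: fun_eq_iff)
    qed
    then show ?thesis by blast
  qed blast
qed

text \<open>
  If every power \<open>l ^ e\<close> were divisible, up to a bounded factor \<open>n\<close>, by a power of \<open>a\<close> of
  comparable size, then two exponents would share both \<open>n\<close> and the bounded cofactor, and
  dividing the two equations gives a multiplicative dependence.
\<close>

lemma power_gap:
  assumes a2: "2 \<le> a" and l2: "2 \<le> l" and nd: "\<not> mult_dependent a l"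
  shows "\<exists>e q. a ^ Suc q \<le> l ^ e \<and> (\<forall>n. 0 < n \<and> n \<le> N \<longrightarrow> \<not> a ^ q dvd l ^ e * n)"
proof (rule ccontr)
  assume contra: "\<not> ?thesis"
  \<comment> \<open>The shift by a ensures l^(e+a) > a, so the largest p with a^p \<le> l^(e+a) is
    positive and q = p - 1 makes sense.\<close>
  have "\<exists>n m q. 0 < n \<and> n \<le> N \<and> m \<le> a * a * N \<and> l ^ (e + a) * n = a ^ q * m" for e
  proof -
    obtain p where p: "a ^ p \<le> l ^ (e + a)" "l ^ (e + a) < a ^ (p + 1)"
      using ex_power_ivl1[of a "l ^ (e + a)"] a2 l2 by auto
    have "a < 2 ^ a" by simp
    also have "(2::nat) ^ a \<le> l ^ a" using l2 by (intro power_mono) auto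
    also have "\<dots> \<le> l ^ (e + a)" using l2 by (intro power_increasing) auto
    finally have "p \<noteq> 0" using p(2) by (intro notI) simp
    then obtain q where q: "p = Suc q" by (cases p) auto
    then obtain n where n: "0 < n" "n \<le> N" "a ^ q dvd l ^ (e + a) * n"
      using contra p(1) by blast
    then obtain m where m: "l ^ (e + a) * n = a ^ q * m" by blast
    have "a ^ q * m \<le> a ^ (p + 1) * N"
      unfolding m[symmetric] using p(2) n by (intro mult_le_mono) auto
    also have "\<dots> = a ^ q * (a * a * N)" by (simp add: q)
    finally have "m \<le> a * a * N" using a2 by simp
    then show ?thesis using n m by blast
  qed
  then obtain n m q where nmq: "\<And>e. 0 < n e" "\<And>e. n e \<le> N" "\<And>e. m e \<le> a * a * N"
      "\<And>e::nat. l ^ (e + a) * n e = a ^ q e * m e"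
    by metis
  have "range (\<lambda>e. (n e, m e)) \<subseteq> {..N} \<times> {..a * a * N}" using nmq by auto
  then have "finite (range (\<lambda>e. (n e, m e)))" by (rule finite_subset) simp
  then have "\<not> inj (\<lambda>e. (n e, m e))" using finite_imageD infinite_UNIV_nat by blast
  then obtain e f where ef: "n e = n f" "m e = m f" "e < f"
    unfolding inj_def by (metis linorder_neqE_nat prod.inject)
  have "0 < l ^ (e + a) * n e" using nmq(1) l2 by simp
  then have m0: "0 < m e" using nmq(4)[of e] by (cases "m e") auto
  have "a ^ q f * m e = l ^ ((f - e) + (e + a)) * n e" using nmq(4)[of f] ef by simp
  also have "\<dots> = l ^ (f - e) * (l ^ (e + a) * n e)" by (simp only: power_add mult.assoc)
  also have "\<dots> = (l ^ (f - e) * a ^ q e) * m e" by (simp add: nmq(4))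
  finally have eq: "a ^ q f = l ^ (f - e) * a ^ q e" using m0 by simp
  have "1 < l ^ (f - e)" using l2 ef(3) by (intro one_less_power) auto
  then have "a ^ q e < a ^ q f" using eq a2 by simp
  then have qq: "q e < q f" using a2 by (simp add: power_strict_increasing_iff)
  have "a ^ q f = a ^ (q f - q e) * a ^ q e" using qq by (simp flip: power_add)
  then have "a ^ (q f - q e) = l ^ (f - e)" using eq a2 by simp
  then have "mult_dependent a l" unfolding mult_dependent_def
    using a2 l2 qq ef(3) by (metis zero_less_diff)
  then show False using nd by blast
qed

text \<open>The range starts at 1 because the offsets y of kernel sequences do.\<close>

lemma ex_add_mod_eq:
  fixes X B c :: nat
  assumes "c < B"
  shows "\<exists>Z. 1 \<le> Z \<and> Z \<le> B \<and> (X + Z) mod B = c"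
proof -
  define r where "r = X mod B"
  have r: "r < B" using assms by (simp add: r_def)
  have X: "(X + Z) mod B = (r + Z) mod B" for Z by (simp add: r_def mod_add_left_eq)
  show ?thesis
  proof (cases "r < c")
    case True
    then have "(X + (c - r)) mod B = c" using assms by (subst X) simp
    moreover have "1 \<le> c - r" "c - r \<le> B" using True assms by auto
    ultimately show ?thesis by blast
  next
    case False
    then have "(X + (B + c - r)) mod B = c" using assms r by (subst X) simp
    moreover have "1 \<le> B + c - r" "B + c - r \<le> B" using False r by auto
    ultimately show ?thesis by blast
  qed
qed

text \<open>
  Two kernel sequences agree below \<open>N\<close>, because there their values only depend on
  \<open>l ^ e * (N - i)\<close>, but differ at \<open>N\<close>.
\<close>

lemma not_k_regular_ruler:
  assumes a2: "2 \<le> a" and l2: "2 \<le> l" and nd: "\<not> mult_dependent a l"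
  shows "\<not> k_regular l (\<lambda>i. int (ruler a i))"
proof
  assume "k_regular l (\<lambda>i. int (ruler a i))"
  then obtain G where G: "finite G"
      "int_seq.span G = int_seq.span (kernel_seqs l (\<lambda>i. int (ruler a i)))"
    by (auto simp: k_regular_def)
  obtain N where N: "\<And>f. f \<in> int_seq.span G \<Longrightarrow> (\<And>i. i < N \<Longrightarrow> f i = 0) \<Longrightarrow> f = 0"
    using finite_span_determined[OF G(1)] by blast
  obtain e q where eq: "a ^ Suc q \<le> l ^ e"
      "\<And>n. 0 < n \<Longrightarrow> n \<le> N \<Longrightarrow> \<not> a ^ q dvd l ^ e * n"
    using power_gap[OF a2 l2 nd, of N] by blast
  define X where "X = l ^ e * N"
  have lt: "a ^ q < a ^ Suc q" using a2 by simp
  \<comment> \<open>\<open>Y\<close> and \<open>Z\<close> are offsets at most l^e whose sequences at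
    N have multiplicity above q and exactly q, respectively.\<close>
  obtain Y where Y: "1 \<le> Y" "Y \<le> a ^ Suc q" "(X + Y) mod a ^ Suc q = 0"
    using ex_add_mod_eq[of 0 "a ^ Suc q" X] lt by fastforce
  obtain Z where Z: "1 \<le> Z" "Z \<le> a ^ Suc q" "(X + Z) mod a ^ Suc q = a ^ q"
    using ex_add_mod_eq[OF lt, of X] by blast
  have dvdY: "a ^ Suc q dvd X + Y" using Y(3) by (simp add: dvd_eq_mod_eq_0 del: power_Suc)
  then have dvdY': "a ^ q dvd X + Y" by (meson dvd_trans le_imp_power_dvd lessI less_imp_le)
  have "a ^ q dvd a ^ Suc q" by simp
  then have dvdZ: "a ^ q dvd X + Z" using Z(3) by (metis dvd_mod_iff dvd_refl)
  have ndZ: "\<not> a ^ Suc q dvd X + Z" using Z(3) a2 by (simp add: dvd_eq_mod_eq_0 del: power_Suc)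
  \<comment> \<open>Modulo a^q the two arguments are negatives of each other, and a^q does not
    divide the second by the choice of q.\<close>
  have below: "multiplicity a (l ^ e * i + W) = multiplicity a (l ^ e * (N - i))"
    if "i < N" "a ^ q dvd X + W" for i W
  proof (rule multiplicity_eq_if_dvd_add)
    show "\<not> a ^ q dvd l ^ e * (N - i)" using that by (intro eq(2)) auto
    have "l ^ e * i + l ^ e * (N - i) = X"
      using that by (simp add: X_def flip: distrib_left)
    then have "l ^ e * i + W + l ^ e * (N - i) = X + W" by simp
    then show "a ^ q dvd l ^ e * i + W + l ^ e * (N - i)" using that(2) by (simp only:)
  qed
  define f where "f = dilated_ruler a (l ^ e) Y - dilated_ruler a (l ^ e) Z"
  have "dilated_ruler a (l ^ e) W \<in> kernel_seqs l (\<lambda>i. int (ruler a i))"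
    if "1 \<le> W" "W \<le> a ^ Suc q" for W
    using kernel_seqs_ruler[of l a] l2 that eq(1) by fastforce
  then have "f \<in> int_seq.span G" unfolding f_def G(2)
    using Y Z by (intro int_seq.span_diff int_seq.span_base) auto
  moreover have "f i = 0" if "i < N" for i
    using below[OF that dvdY'] below[OF that dvdZ] by (simp add: f_def dilated_ruler_def)
  ultimately have "f = 0" by (rule N)
  then have "f N = 0" by simp
  then have "multiplicity a (X + Y) = multiplicity a (X + Z)"
    by (simp add: f_def dilated_ruler_def X_def)
  moreover have "Suc q \<le> multiplicity a (X + Y)"
    using dvdY a2 Y by (intro multiplicity_geI) auto
  moreover have "multiplicity a (X + Z) < Suc q"
    using ndZ a2 Z by (intro multiplicity_lessI) auto
  ultimately show False by simp
qed

theorem theorem3p1: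
  fixes a b :: nat
  assumes "0 < a" and "0 < b" and "coprime a b"
    and "real a / real b \<ge> 2"
  shows "lex_least_word a b = lex_least_word a 1 \<and> rho a b = mult_class a"
proof -
  have "real (2 * b) \<le> real a" using assms by (simp add: field_simps)
  then have ab: "2 * b \<le> a" by linarith
  then have a2: "2 \<le> a" using assms by linarith
  have w: "lex_least_word a b = ruler a"
    using assms ab by (intro lex_least_word_eq_ruler) auto
  moreover have "lex_least_word a 1 = ruler a"
    using a2 by (intro lex_least_word_eq_ruler) auto
  moreover have "rho a b = mult_class a"
  proof -
    have "k_regular l (\<lambda>i. int (ruler a i)) \<longleftrightarrow> mult_dependent a l" if "2 \<le> l" for l
      using k_regular_ruler not_k_regular_ruler[OF a2 that] by blast
    moreover have "2 \<le> l" if "mult_dependent a l" for l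
      using that by (simp add: mult_dependent_def)
    ultimately show ?thesis by (auto simp: rho_def mult_class_def w)
  qed
  ultimately show ?thesis by simp
qed

end
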